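(* Let $\mathbb{L}^d=\mathbb{S}^d$ (for all $d\ge1$) or $\mathbb{L}^d=\operatorname{diag}(\mathbb{R}^d)$ (for all $d\ge1$). For a norm $\|\cdot\|$ defined on $\mathbb{L}^d$ for all $d\ge1$, let the norm cone in $\mathbb{S}^{d+1}$ (respectively $\operatorname{diag}(\mathbb{R}^{d+1})$) be $$N^{d+1}_{\|\cdot\|}=\{\operatorname{diag}(t,X): \|X\|\le t,\ X\in\mathbb{L}^d,\ t\in\mathbb{R}\},$$ and $N^1_{\|\cdot\|}=\mathbb{R}_+$. If the norm is consistent and monotonic, then the sequence of norm cones $\{N^k_{\|\cdot\|}\}_{k=1}^\infty$ satisfies the embedding property with index map $I_{\mathsf{SOC}}(d,k)$. The converse is also true: if $\{N^k_{\|\cdot\|}\}_{k=1}^\infty$ satisfies the embedding property with index map $I_{\mathsf{SOC}}(d,k)$, then the norm is consistent and monotonic.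
   Context: $\mathbb{S}^d$ is the space of $d\times d$ Hermitian matrices over $\mathbb{F}=\mathbb{R},\mathbb{C},\mathbb{H}$ (quaternions) or $\mathbb{O}$ (octonions), and $\operatorname{diag}(\mathbb{R}^d)$ is the space of real diagonal $d\times d$ matrices. $\operatorname{diag}(t,X)$ is the block diagonal matrix with blocks $t$ and $X$. $[d]=\{1,\dots,d\}$ and $\binom{[d]}{k}$ is the set of increasing sequences of length $k$ in $[d]$. For $(i_1,\dots,i_k)\in\binom{[d]}{k}$, the truncation operator $\tau^d_{i_1\cdots i_k}:\mathbb{S}^d\to\mathbb{S}^k$ sends $Z$ to its principal submatrix $[z_{i_pi_q}]_{p,q=1}^k$; the lift operator $\varepsilon^d_{i_1\cdots i_k}:\mathbb{S}^k\to\mathbb{S}^d$ sends $X$ to the matrix with $(i_p,i_q)$ entry $x_{pq}$ and other entries $0$ (both take diagonal matrices to diagonal matrices). The norm (defined on $\mathbb{L}^d$ for every $d$) is consistent if $\|\tau^d_{i_1\cdots i_k}(X)\|=\|\varepsilon^d_{i_1\cdots i_k}(\tau^d_{i_1\cdots i_k}(X))\|$, and monotonic if $\|\tau^d_{i_1\cdots i_k}(X)\|\le\|X\|$, in each case for any $1\le k\le d$, any $X\in\mathbb{L}^d$ and any $(i_1,\dots,i_k)\in\binom{[d]}{k}$. The index map is $I_{\mathsf{SOC}}(d,k)=\{(1,i_1,\dots,i_{k-1}):2\le i_1<\dots<i_{k-1}\le d\}$ for $k\ge2$, and $I_{\mathsf{SOC}}(d,1)=\{1\}$ (the single sequence $(1)$).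 A sequence $\{\mathsf{K}^k\}_{k=1}^\infty$ of convex proper cones $\mathsf{K}^k\subseteq\mathbb{S}^k$ (proper: solid, i.e. with nonempty interior, convex, pointed and closed) satisfies the embedding property with index map $I$, where $I(d,k)\subseteq\binom{[d]}{k}$, if for all $d\ge k\ge1$ and $(i_1,\dots,i_k)\in I(d,k)$: $\tau^d_{i_1\cdots i_k}(Z)\in\mathsf{K}^k$ for all $Z\in\mathsf{K}^d$ and $\varepsilon^d_{i_1\cdots i_k}(X)\in\mathsf{K}^d$ for all $X\in\mathsf{K}^k$.
   Formalization: Norm cones over S^d consist of block diagonal matrices and have empty interior in S^{d+1}, so properness (nonempty interior, closedness) is taken relative to the space {diag(t,X): t real, X in L^d} instead of S^{d+1}; for diagonal matrices nothing changes. *)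

theory Defs
  imports
    "HOL-Analysis.Product_Vector"
    "HOL-Analysis.Product_Topology"
    "HOL-Analysis.Function_Topology"
    "Jordan_Normal_Form.Matrix"
begin

section \<open>Quaternions and octonions\<close>

text \<open>
  The quaternions are the Cayley--Dickson double of the complex numbers and the octonions that of
  the quaternions. The octonions are not associative, so none of the library's ring classes above
  the level of a normed vector space applies to all four scalar algebras.
\<close>

class star_algebra = real_normed_vector + times + one + conjugate

instance real :: star_algebra ..
instance complex :: star_algebra ..

typedef 'a cayley_dickson = "UNIV :: ('a \<times> 'a) set" ..

setup_lifting type_definition_cayley_dickson

instantiation cayley_dickson :: (star_algebra) real_vector
begin

lift_definition zero_cayley_dickson :: "'a cayley_dickson" is "(0, 0)" .
lift_definition plus_cayley_dickson ::
  "'a cayley_dickson \<Rightarrow> 'a cayley_dickson \<Rightarrow> 'a cayley_dickson" is "(+)" .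
lift_definition minus_cayley_dickson ::
  "'a cayley_dickson \<Rightarrow> 'a cayley_dickson \<Rightarrow> 'a cayley_dickson" is "(-)" .
lift_definition uminus_cayley_dickson :: "'a cayley_dickson \<Rightarrow> 'a cayley_dickson" is "uminus" .
lift_definition scaleR_cayley_dickson :: "real \<Rightarrow> 'a cayley_dickson \<Rightarrow> 'a cayley_dickson"
  is "scaleR" .

instance
proof
  fix x y z :: "'a cayley_dickson" and r s :: real
  show "x + y + z = x + (y + z)" by transfer (rule add.assoc)
  show "x + y = y + x" by transfer (rule add.commute)
  show "0 + x = x" by transfer (simp flip: zero_prod_def)
  show "- x + x = 0" by transfer (simp flip: zero_prod_def)
  show "x - y = x + - y" by transfer simp
  show "r *\<^sub>R (x + y) = r *\<^sub>R x + r *\<^sub>R y" by transfer (rule scaleR_add_right)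
  show "(r + s) *\<^sub>R x = r *\<^sub>R x + s *\<^sub>R x" by transfer (rule scaleR_add_left)
  show "r *\<^sub>R s *\<^sub>R x = (r * s) *\<^sub>R x" by transfer simp
  show "1 *\<^sub>R x = x" by transfer simp
qed

end

instantiation cayley_dickson :: (star_algebra) star_algebra
begin

lift_definition one_cayley_dickson :: "'a cayley_dickson" is "(1, 0)" .
lift_definition times_cayley_dickson ::
  "'a cayley_dickson \<Rightarrow> 'a cayley_dickson \<Rightarrow> 'a cayley_dickson"
  is "\<lambda>(a, b) (c, d). (a * c - conjugate d * b, d * a + b * conjugate c)" .
lift_definition conjugate_cayley_dickson :: "'a cayley_dickson \<Rightarrow> 'a cayley_dickson"
  is "\<lambda>(a, b). (conjugate a, - b)" .
lift_definition norm_cayley_dickson :: "'a cayley_dickson \<Rightarrow> real" is "norm" .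

definition sgn_cayley_dickson :: "'a cayley_dickson \<Rightarrow> 'a cayley_dickson" where
  "sgn_cayley_dickson x = x /\<^sub>R norm x"
definition dist_cayley_dickson :: "'a cayley_dickson \<Rightarrow> 'a cayley_dickson \<Rightarrow> real" where
  "dist_cayley_dickson x y = norm (x - y)"
definition uniformity_cayley_dickson :: "('a cayley_dickson \<times> 'a cayley_dickson) filter" where
  "uniformity_cayley_dickson = (INF e\<in>{0<..}. principal {(x, y). dist x y < e})"
definition open_cayley_dickson :: "'a cayley_dickson set \<Rightarrow> bool" where
  "open_cayley_dickson U \<longleftrightarrow> (\<forall>x\<in>U. eventually (\<lambda>(x', y). x' = x \<longrightarrow> y \<in> U) uniformity)"

instance
proof
  fix x y z :: "'a cayley_dickson" and r :: real and U :: "'a cayley_dickson set"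
  show "sgn x = x /\<^sub>R norm x" by (rule sgn_cayley_dickson_def)
  show "dist x y = norm (x - y)" by (rule dist_cayley_dickson_def)
  show "uniformity = (INF e\<in>{0<..}. principal {(x :: 'a cayley_dickson, y). dist x y < e})"
    by (rule uniformity_cayley_dickson_def)
  show "open U \<longleftrightarrow> (\<forall>x\<in>U. eventually (\<lambda>(x', y). x' = x \<longrightarrow> y \<in> U) uniformity)"
    by (rule open_cayley_dickson_def)
  show "norm x = 0 \<longleftrightarrow> x = 0" by transfer (simp flip: zero_prod_def)
  show "norm (x + y) \<le> norm x + norm y" by transfer (rule norm_triangle_ineq)
  show "norm (r *\<^sub>R x) = \<bar>r\<bar> * norm x" by transfer simp
  show "conjugate (conjugate x) = x" by transfer auto
  show "conjugate x = conjugate y \<longleftrightarrow> x = y" by transfer auto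
qed

end

type_synonym quaternion = "complex cayley_dickson"
type_synonym octonion = "quaternion cayley_dickson"


section \<open>Spaces of matrices\<close>

definition hermitian_mats :: "nat \<Rightarrow> 'a::star_algebra mat set" where
  "hermitian_mats d = {A \<in> carrier_mat d d. \<forall>i<d. \<forall>j<d. A $$ (i, j) = conjugate (A $$ (j, i))}"

definition diagonal_mats :: "nat \<Rightarrow> real mat set" where
  "diagonal_mats d = {A \<in> carrier_mat d d. diagonal_mat A}"

text \<open>
  A matrix carries its dimensions, so a single function on matrices is the same as a family of
  functions, one on each \<open>L d\<close>.
\<close>

definition norm_on_spaces :: "(nat \<Rightarrow> 'a::star_algebra mat set) \<Rightarrow> ('a mat \<Rightarrow> real) \<Rightarrow> bool" where
  "norm_on_spaces L nrm \<longleftrightarrow>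
    (\<forall>d\<ge>1.
      (\<forall>X\<in>L d. 0 \<le> nrm X \<and> (nrm X = 0 \<longleftrightarrow> X = 0\<^sub>m d d)) \<and>
      (\<forall>X\<in>L d. \<forall>c. nrm (map_mat (scaleR c) X) = \<bar>c\<bar> * nrm X) \<and>
      (\<forall>X\<in>L d. \<forall>Y\<in>L d. nrm (X + Y) \<le> nrm X + nrm Y))"


section \<open>Truncation and lift\<close>

text \<open>Indices start at \<open>0\<close>, as in the matrix library: \<open>[d]\<close> becomes \<open>{..<d}\<close>.\<close>

definition increasing_seqs :: "nat \<Rightarrow> nat \<Rightarrow> nat list set" where
  "increasing_seqs d k = {is. length is = k \<and> sorted_wrt (<) is \<and> set is \<subseteq> {..<d}}"

definition truncate :: "nat list \<Rightarrow> 'a mat \<Rightarrow> 'a mat" where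
  "truncate is Z = mat (length is) (length is) (\<lambda>(p, q). Z $$ (is ! p, is ! q))"

definition lift :: "nat \<Rightarrow> nat list \<Rightarrow> 'a::zero mat \<Rightarrow> 'a mat" where
  "lift d is X = mat d d (\<lambda>(i, j).
     if i \<in> set is \<and> j \<in> set is
     then X $$ (inv_into {..<length is} ((!) is) i, inv_into {..<length is} ((!) is) j)
     else 0)"

lemma lift_index:
  assumes "is \<in> increasing_seqs d k" "p < k" "q < k"
  shows "lift d is X $$ (is ! p, is ! q) = X $$ (p, q)"
proof -
  have "distinct is"
    using assms(1) by (auto simp: increasing_seqs_def strict_sorted_iff)
  then have "inj_on ((!) is) {..<length is}"
    by (simp add: inj_on_nth)
  moreover have "length is = k" "is ! p < d" "is ! q < d"
    using assms by (auto simp: increasing_seqs_def dest!: nth_mem)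
  ultimately show ?thesis
    using assms(2,3) by (simp add: lift_def)
qed

lemma lift_index_outside:
  "i < d \<Longrightarrow> j < d \<Longrightarrow> i \<notin> set is \<or> j \<notin> set is \<Longrightarrow> lift d is X $$ (i, j) = 0"
  by (auto simp: lift_def)

definition consistent :: "(nat \<Rightarrow> 'a::zero mat set) \<Rightarrow> ('a mat \<Rightarrow> real) \<Rightarrow> bool" where
  "consistent L nrm \<longleftrightarrow>
    (\<forall>d k. 1 \<le> k \<and> k \<le> d \<longrightarrow> (\<forall>X\<in>L d. \<forall>is\<in>increasing_seqs d k.
      nrm (truncate is X) = nrm (lift d is (truncate is X))))"

definition monotonic :: "(nat \<Rightarrow> 'a mat set) \<Rightarrow> ('a mat \<Rightarrow> real) \<Rightarrow> bool" where
  "monotonic L nrm \<longleftrightarrow>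
    (\<forall>d k. 1 \<le> k \<and> k \<le> d \<longrightarrow> (\<forall>X\<in>L d. \<forall>is\<in>increasing_seqs d k.
      nrm (truncate is X) \<le> nrm X))"


section \<open>Proper cones and the embedding property\<close>

text \<open>The topology of entrywise convergence on the \<open>k \<times> k\<close> matrices.\<close>

definition mat_topology :: "nat \<Rightarrow> 'a::topological_space mat topology" where
  "mat_topology k = pullback_topology (carrier_mat k k)
     (\<lambda>A. \<lambda>ij\<in>{..<k} \<times> {..<k}. A $$ ij)
     (product_topology (\<lambda>_. euclidean) ({..<k} \<times> {..<k}))"

text \<open>
  Convex proper cones of \<open>k \<times> k\<close> matrices relative to an ambient space \<open>V\<close>. The ambient space has
  to be a parameter: norm cones consist of block diagonal matrices and hence have empty interior
  in the space of all Hermitian matrices.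
\<close>

definition convex_proper_cone :: "nat \<Rightarrow> 'a::star_algebra mat set \<Rightarrow> 'a mat set \<Rightarrow> bool" where
  "convex_proper_cone k V K \<longleftrightarrow>
    K \<subseteq> V \<and>
    (\<forall>A\<in>K. \<forall>c\<ge>0. map_mat (scaleR c) A \<in> K) \<and>
    (\<forall>A\<in>K. \<forall>B\<in>K. \<forall>u\<in>{0..1}. map_mat (scaleR (1 - u)) A + map_mat (scaleR u) B \<in> K) \<and>
    (\<forall>A. A \<in> K \<and> - A \<in> K \<longrightarrow> A = 0\<^sub>m k k) \<and>
    closedin (subtopology (mat_topology k) V) K \<and>
    (subtopology (mat_topology k) V) interior_of K \<noteq> {}"

definition embedding_property ::
  "(nat \<Rightarrow> 'a::star_algebra mat set) \<Rightarrow> (nat \<Rightarrow> 'a mat set) \<Rightarrow> (nat \<Rightarrow> nat \<Rightarrow> nat list set) \<Rightarrow> bool"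
  where
  "embedding_property V K I \<longleftrightarrow>
    (\<forall>k\<ge>1. convex_proper_cone k (V k) (K k)) \<and>
    (\<forall>d k. 1 \<le> k \<and> k \<le> d \<longrightarrow> (\<forall>is\<in>I d k.
      (\<forall>Z\<in>K d. truncate is Z \<in> K k) \<and> (\<forall>X\<in>K k. lift d is X \<in> K d)))"

text \<open>The sequences starting with the first index, which is \<open>0\<close> here; for \<open>k = 1\<close> only \<open>[0]\<close>.\<close>

definition soc_index :: "nat \<Rightarrow> nat \<Rightarrow> nat list set" where
  "soc_index d k =
    (if k = 1 then {[0]}
     else {0 # is | is. length is = k - 1 \<and> sorted_wrt (<) is \<and> set is \<subseteq> {1..<d}})"

lemma soc_index_subset_increasing_seqs:
  "1 \<le> k \<Longrightarrow> k \<le> d \<Longrightarrow> soc_index d k \<subseteq> increasing_seqs d k"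
  by (auto simp: soc_index_def increasing_seqs_def subset_eq Suc_le_eq split: if_splits)


section \<open>Norm cones\<close>

definition real_block :: "real \<Rightarrow> 'a::star_algebra mat" where
  "real_block t = mat 1 1 (\<lambda>_. t *\<^sub>R 1)"

definition norm_cone :: "(nat \<Rightarrow> 'a::star_algebra mat set) \<Rightarrow> ('a mat \<Rightarrow> real) \<Rightarrow> nat \<Rightarrow> 'a mat set"
  where
  "norm_cone L nrm k =
    (if k = 1 then {real_block t | t. 0 \<le> t}
     else {diag_block_mat [real_block t, X] | t X. X \<in> L (k - 1) \<and> nrm X \<le> t})"

definition norm_cone_space :: "(nat \<Rightarrow> 'a::star_algebra mat set) \<Rightarrow> nat \<Rightarrow> 'a mat set" where
  "norm_cone_space L k =
    (if k = 1 then range real_block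
     else {diag_block_mat [real_block t, X] | t X. X \<in> L (k - 1)})"

end

theory Submission
  imports Defs
begin

text \<open>
  Write \<open>N\<close> for the given norm, extended by \<open>0\<close> to the empty matrix. With this extension every norm
  cone, including the half-line of \<open>1 \<times> 1\<close> matrices, consists of the matrices \<open>diag(t, X)\<close> with
  \<open>N X \<le> t\<close>, and an index sequence in \<open>soc_index (n + 1) (m + 1)\<close> is the border index \<open>0\<close> followed by
  a shifted increasing sequence \<open>js\<close> of length \<open>m\<close> in \<open>{..<n}\<close>. Truncation and lift along such a
  sequence leave the corner \<open>t\<close> alone and act on \<open>X\<close> as truncation and lift along \<open>js\<close>
  (\<open>truncate_bordered\<close>, \<open>lift_bordered\<close>). Taking \<open>t = N X\<close>, the embedding conditions say exactly that
  neither operation along \<open>js\<close> increases \<open>N\<close> (\<open>embedding_property_iff\<close>). For truncation this is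
  monotonicity. For lifts it is consistency: truncation undoes the lift, so that monotonicity gives
  \<open>N X \<le> N (lift X)\<close> and the reverse inequality is the only content of consistency
  (\<open>consistent_monotonic_iff\<close>).

  The embedding property also demands that the norm cones are convex proper cones, and this holds for
  every norm. A norm cone is the set where the superlinear function \<open>diag(t, X) \<mapsto> t - N X\<close> is
  nonnegative, so convexity is clear, pointedness is definiteness of the norm, and closedness and
  nonempty interior follow from continuity for entrywise convergence
  (\<open>convex_proper_cone_superlevel\<close>). Continuity in turn only needs a bound of \<open>N\<close> by a multiple of the
  sum of the norms of the entries. Such a bound comes from writing a matrix as a sum of matrices that
  each depend on one entry; what remains is that a seminorm on the scalar algebra is bounded, which
  Cayley--Dickson doubling preserves.
\<close>


section \<open>The scalar algebras\<close>

text \<open>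
  Boundedness of seminorms is finite-dimensionality in the form in which it is used below; stated this
  way it avoids bases, which would have to be carried through the doubling.
\<close>

class hypercomplex = star_algebra + zero_neq_one +
  assumes conjugate_add: "conjugate (a + b) = conjugate a + conjugate b"
    and conjugate_scaleR: "conjugate (r *\<^sub>R a) = r *\<^sub>R conjugate a"
    and seminorm_bounded:
      "(\<And>a b. g (a + b) \<le> g a + g b) \<Longrightarrow> (\<And>r a. g (r *\<^sub>R a) = \<bar>r\<bar> * g a) \<Longrightarrow>
        \<exists>C. \<forall>a. g a \<le> C * norm a"

lemma conjugate_0 [simp]: "conjugate (0 :: 'a::hypercomplex) = 0"
  using conjugate_scaleR[of 0 "0 :: 'a"] by simp

instance real :: hypercomplex
proof
  fix g :: "real \<Rightarrow> real"
  assume scale: "\<And>r a. g (r *\<^sub>R a) = \<bar>r\<bar> * g a"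
  have "g a \<le> g 1 * norm a" for a
    using scale[of a 1] by (simp add: mult.commute)
  then show "\<exists>C. \<forall>a. g a \<le> C * norm a"
    by blast
qed simp_all

instance complex :: hypercomplex
proof
  fix g :: "complex \<Rightarrow> real"
  assume add: "\<And>a b. g (a + b) \<le> g a + g b" and scale: "\<And>r a. g (r *\<^sub>R a) = \<bar>r\<bar> * g a"
  have "g z \<le> (\<bar>g 1\<bar> + \<bar>g \<i>\<bar>) * norm z" for z
  proof -
    have z: "Re z *\<^sub>R 1 + Im z *\<^sub>R \<i> = z"
      by (simp add: complex_eq_iff)
    have "g z \<le> \<bar>Re z\<bar> * g 1 + \<bar>Im z\<bar> * g \<i>"
      using add[of "Re z *\<^sub>R 1" "Im z *\<^sub>R \<i>"] unfolding z scale .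
    also have "\<dots> \<le> \<bar>Re z\<bar> * \<bar>g 1\<bar> + \<bar>Im z\<bar> * \<bar>g \<i>\<bar>"
      by (intro add_mono mult_left_mono) auto
    also have "\<dots> \<le> norm z * \<bar>g 1\<bar> + norm z * \<bar>g \<i>\<bar>"
      by (intro add_mono mult_right_mono abs_Re_le_cmod abs_Im_le_cmod) auto
    finally show ?thesis
      by (simp add: algebra_simps)
  qed
  then show "\<exists>C. \<forall>a. g a \<le> C * norm a"
    by blast
qed (simp_all add: conjugate_complex_def scaleR_conv_of_real)

lift_definition cd_pair :: "'a::star_algebra \<Rightarrow> 'a \<Rightarrow> 'a cayley_dickson" is Pair .

lemma cd_pair_cases: obtains a b where "x = cd_pair a b"
  by transfer auto

lemma cd_pair_add: "cd_pair a b + cd_pair c d = cd_pair (a + c) (b + d)"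
  by transfer simp

lemma cd_pair_scaleR: "r *\<^sub>R cd_pair a b = cd_pair (r *\<^sub>R a) (r *\<^sub>R b)"
  by transfer simp

lemma norm_le_norm_cd_pair: "norm a \<le> norm (cd_pair a b)" "norm b \<le> norm (cd_pair a b)"
  by (transfer, simp add: norm_Pair)+

text \<open>A seminorm on the double is at most the sum of its restrictions to the two halves.\<close>

instance cayley_dickson :: (hypercomplex) hypercomplex
proof
  show "(0 :: 'a cayley_dickson) \<noteq> 1"
    by transfer simp
  show "conjugate (a + b) = conjugate a + conjugate b" for a b :: "'a cayley_dickson"
    by transfer (auto simp: conjugate_add)
  show "conjugate (r *\<^sub>R a) = r *\<^sub>R conjugate a" for r and a :: "'a cayley_dickson"
    by transfer (auto simp: conjugate_scaleR)
  fix g :: "'a cayley_dickson \<Rightarrow> real"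
  assume add: "\<And>a b. g (a + b) \<le> g a + g b" and scale: "\<And>r a. g (r *\<^sub>R a) = \<bar>r\<bar> * g a"
  have "\<exists>C. \<forall>a. g (cd_pair a 0) \<le> C * norm a"
    by (rule seminorm_bounded)
       (use add[of "cd_pair _ 0" "cd_pair _ 0"] scale[of _ "cd_pair _ 0"] in
         \<open>simp_all add: cd_pair_add cd_pair_scaleR\<close>)
  then obtain C where C: "\<And>a. g (cd_pair a 0) \<le> C * norm a"
    by blast
  have "\<exists>D. \<forall>b. g (cd_pair 0 b) \<le> D * norm b"
    by (rule seminorm_bounded)
       (use add[of "cd_pair 0 _" "cd_pair 0 _"] scale[of _ "cd_pair 0 _"] in
         \<open>simp_all add: cd_pair_add cd_pair_scaleR\<close>)
  then obtain D where D: "\<And>b. g (cd_pair 0 b) \<le> D * norm b"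
    by blast
  have "g x \<le> (\<bar>C\<bar> + \<bar>D\<bar>) * norm x" for x
  proof -
    obtain a b where x: "x = cd_pair a b"
      by (rule cd_pair_cases)
    have "g x \<le> g (cd_pair a 0) + g (cd_pair 0 b)"
      using add[of "cd_pair a 0" "cd_pair 0 b"] by (simp add: x cd_pair_add)
    also have "\<dots> \<le> C * norm a + D * norm b"
      by (rule add_mono[OF C D])
    also have "\<dots> \<le> \<bar>C\<bar> * norm x + \<bar>D\<bar> * norm x"
      unfolding x by (intro add_mono mult_mono norm_le_norm_cd_pair) auto
    finally show ?thesis
      by (simp add: algebra_simps)
  qed
  then show "\<exists>C. \<forall>a. g a \<le> C * norm a"
    by blast
qed


section \<open>Seminorms on spaces of matrices\<close>

text \<open>
  Matrices of all sizes share one type, which is therefore not a vector space; subspaces and seminorms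
  are spelled out on carriers.
\<close>

definition mat_subspace :: "nat \<Rightarrow> 'a::real_vector mat set \<Rightarrow> bool" where
  "mat_subspace d V \<longleftrightarrow> V \<subseteq> carrier_mat d d \<and> 0\<^sub>m d d \<in> V \<and>
    (\<forall>X\<in>V. \<forall>Y\<in>V. X + Y \<in> V) \<and> (\<forall>X\<in>V. \<forall>c. map_mat (scaleR c) X \<in> V)"

definition mat_seminorm :: "'a::real_vector mat set \<Rightarrow> ('a mat \<Rightarrow> real) \<Rightarrow> bool" where
  "mat_seminorm V N \<longleftrightarrow>
    (\<forall>X\<in>V. \<forall>c. N (map_mat (scaleR c) X) = \<bar>c\<bar> * N X) \<and> (\<forall>X\<in>V. \<forall>Y\<in>V. N (X + Y) \<le> N X + N Y)"

definition entry_norm :: "nat \<Rightarrow> 'a::real_normed_vector mat \<Rightarrow> real" where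
  "entry_norm d X = (\<Sum>i<d. \<Sum>j<d. norm (X $$ (i, j)))"

lemma mat_seminorm_zero:
  assumes "mat_subspace d V" "mat_seminorm V N"
  shows "N (0\<^sub>m d d) = 0"
proof -
  have "map_mat (scaleR 0) (0\<^sub>m d d :: 'a mat) = 0\<^sub>m d d"
    by (rule eq_matI) auto
  moreover have "0\<^sub>m d d \<in> V"
    using assms(1) by (simp add: mat_subspace_def)
  then have "N (map_mat (scaleR 0) (0\<^sub>m d d)) = \<bar>0\<bar> * N (0\<^sub>m d d)"
    using assms(2) unfolding mat_seminorm_def by blast
  ultimately show ?thesis
    by simp
qed

text \<open>
  Finite subadditivity. The sum of matrices is formed entrywise because matrix addition has no neutral
  element on the whole type.
\<close>

lemma mat_seminorm_sum:
  assumes V: "mat_subspace d V" and N: "mat_seminorm V N"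
    and "finite S" "\<And>s. s \<in> S \<Longrightarrow> M s \<in> V"
  shows "mat d d (\<lambda>p. \<Sum>s\<in>S. M s $$ p) \<in> V \<and> N (mat d d (\<lambda>p. \<Sum>s\<in>S. M s $$ p)) \<le> (\<Sum>s\<in>S. N (M s))"
  using assms(3,4)
proof (induction S rule: finite_induct)
  case empty
  have "mat d d (\<lambda>p. \<Sum>s\<in>{}. M s $$ p) = 0\<^sub>m d d"
    by (rule eq_matI) auto
  then show ?case
    using V mat_seminorm_zero[OF V N] by (simp add: mat_subspace_def)
next
  case (insert s S)
  let ?X = "mat d d (\<lambda>p. \<Sum>s\<in>S. M s $$ p)"
  have "M s \<in> V" and X: "?X \<in> V" "N ?X \<le> (\<Sum>s\<in>S. N (M s))"
    using insert by auto
  moreover have "M s \<in> carrier_mat d d"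
    using V \<open>M s \<in> V\<close> by (auto simp: mat_subspace_def)
  then have "mat d d (\<lambda>p. \<Sum>s\<in>insert s S. M s $$ p) = M s + ?X"
    using insert.hyps by (intro eq_matI) auto
  moreover have "N (M s + ?X) \<le> N (M s) + N ?X" "M s + ?X \<in> V"
    using V N \<open>M s \<in> V\<close> X(1) by (auto simp: mat_subspace_def mat_seminorm_def)
  ultimately show ?case
    using insert.hyps by simp
qed

lemma sum_mult_le_sum_abs_mult_sum:
  fixes a b :: "'s \<Rightarrow> real"
  assumes "finite S" "\<And>s. s \<in> S \<Longrightarrow> 0 \<le> b s"
  shows "(\<Sum>s\<in>S. a s * b s) \<le> (\<Sum>s\<in>S. \<bar>a s\<bar>) * (\<Sum>s\<in>S. b s)"
proof -
  have "a s * b s \<le> (\<Sum>s\<in>S. \<bar>a s\<bar>) * b s" if "s \<in> S" for s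
  proof -
    have "a s \<le> \<bar>a s\<bar>" by simp
    also have "\<dots> \<le> (\<Sum>s\<in>S. \<bar>a s\<bar>)"
      using that assms by (intro member_le_sum) auto
    finally show ?thesis
      using assms that by (intro mult_right_mono) auto
  qed
  then show ?thesis
    unfolding sum_distrib_left by (rule sum_mono)
qed

text \<open>
  The defining equation of Hermitian matrices rewrites forever as a simplification rule; these three
  rules package it in a usable direction.
\<close>

lemma hermitian_matsI:
  "A \<in> carrier_mat d d \<Longrightarrow> (\<And>i j. i < d \<Longrightarrow> j < d \<Longrightarrow> A $$ (i, j) = conjugate (A $$ (j, i))) \<Longrightarrow>
    A \<in> hermitian_mats d"
  unfolding hermitian_mats_def by blast

lemma hermitian_mats_carrier: "A \<in> hermitian_mats d \<Longrightarrow> A \<in> carrier_mat d d"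
  unfolding hermitian_mats_def by blast

lemma hermitian_mats_conjugate:
  "A \<in> hermitian_mats d \<Longrightarrow> i < d \<Longrightarrow> j < d \<Longrightarrow> conjugate (A $$ (j, i)) = A $$ (i, j)"
  unfolding hermitian_mats_def by (rule sym) blast

lemma mat_subspace_hermitian: "mat_subspace d (hermitian_mats d :: 'a::hypercomplex mat set)"
  unfolding mat_subspace_def
proof (intro conjI subsetI ballI allI)
  show "0\<^sub>m d d \<in> (hermitian_mats d :: 'a mat set)"
    by (rule hermitian_matsI) simp_all
  show "X + Y \<in> hermitian_mats d" if "X \<in> hermitian_mats d" "Y \<in> hermitian_mats d"
    for X Y :: "'a mat"
    using hermitian_mats_carrier[OF that(1)] hermitian_mats_carrier[OF that(2)]
    by (intro hermitian_matsI) (simp_all add: conjugate_add hermitian_mats_conjugate[OF that(1)]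
        hermitian_mats_conjugate[OF that(2)])
  show "map_mat (scaleR c) X \<in> hermitian_mats d" if "X \<in> hermitian_mats d" for X :: "'a mat" and c
    using hermitian_mats_carrier[OF that]
    by (intro hermitian_matsI) (simp_all add: conjugate_scaleR hermitian_mats_conjugate[OF that])
qed (rule hermitian_mats_carrier)

lemma mat_subspace_diagonal: "mat_subspace d (diagonal_mats d)"
  unfolding mat_subspace_def diagonal_mats_def diagonal_mat_def by auto

text \<open>
  A Hermitian \<open>X\<close> is half the sum of the matrices \<open>H (i, j) x\<^sub>i\<^sub>j\<close>, where \<open>H (i, j) a\<close> has the entry
  \<open>a\<close> at \<open>(i, j)\<close> plus the entry \<open>conjugate a\<close> at \<open>(j, i)\<close>. Since \<open>H s\<close> is real linear, \<open>a \<mapsto> N (H s a)\<close>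
  is a seminorm on the scalars and thus bounded. Summing over all pairs and halving treats diagonal and
  off-diagonal entries alike.
\<close>

lemma hermitian_seminorm_bounded:
  fixes N :: "'a::hypercomplex mat \<Rightarrow> real"
  assumes N: "mat_seminorm (hermitian_mats d) N"
  shows "\<exists>C. \<forall>X\<in>hermitian_mats d. N X \<le> C * entry_norm d X"
proof -
  define H :: "nat \<times> nat \<Rightarrow> 'a \<Rightarrow> 'a mat" where
    "H s a = mat d d (\<lambda>(p, q). of_bool (s = (p, q)) *\<^sub>R a + of_bool (s = (q, p)) *\<^sub>R conjugate a)"
    for s a
  have H: "H s a \<in> hermitian_mats d" for s a
    by (rule hermitian_matsI) (simp_all add: H_def conjugate_add conjugate_scaleR add.commute)
  have "\<exists>C. \<forall>a. N (H s a) \<le> C * norm a" for s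
  proof (rule seminorm_bounded)
    have add: "H s (a + b) = H s a + H s b" for a b
      by (rule eq_matI) (simp_all add: H_def conjugate_add scaleR_add_right)
    show "N (H s (a + b)) \<le> N (H s a) + N (H s b)" for a b
      unfolding add using N H unfolding mat_seminorm_def by blast
    have scale: "H s (r *\<^sub>R a) = map_mat (scaleR r) (H s a)" for r a
      by (rule eq_matI) (simp_all add: H_def conjugate_scaleR scaleR_add_right mult.commute)
    show "N (H s (r *\<^sub>R a)) = \<bar>r\<bar> * N (H s a)" for r a
      unfolding scale using N H unfolding mat_seminorm_def by blast
  qed
  then obtain C where C: "\<And>s a. N (H s a) \<le> C s * norm a"
    by metis
  let ?S = "{..<d} \<times> {..<d}"
  have "N X \<le> (1/2 * (\<Sum>s\<in>?S. \<bar>C s\<bar>)) * entry_norm d X" if X: "X \<in> hermitian_mats d" for X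
  proof -
    have entries: "(\<Sum>s\<in>?S. H s (X $$ s) $$ (p, q)) = 2 *\<^sub>R X $$ (p, q)" if "p < d" "q < d" for p q
    proof -
      have "(\<Sum>s\<in>?S. H s (X $$ s) $$ (p, q)) =
          (\<Sum>s\<in>?S. if s = (p, q) then X $$ s else 0) + (\<Sum>s\<in>?S. if s = (q, p) then conjugate (X $$ s) else 0)"
        using that by (simp add: H_def sum.distrib if_distrib[of "\<lambda>c. c *\<^sub>R _"] of_bool_def cong: if_cong)
      also have "\<dots> = X $$ (p, q) + conjugate (X $$ (q, p))"
        using that by (simp add: sum.delta)
      also have "conjugate (X $$ (q, p)) = X $$ (p, q)"
        using hermitian_mats_conjugate[OF X] that by simp
      finally show ?thesis
        by (simp add: scaleR_2)
    qed
    \<comment> \<open>The matrix \<open>?T\<close> is \<open>2 X\<close>, its \<open>(p, q)\<close> entry being \<open>x\<^sub>p\<^sub>q\<close> plus the conjugate of \<open>x\<^sub>q\<^sub>p\<close>.\<close>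
    let ?T = "mat d d (\<lambda>p. \<Sum>s\<in>?S. H s (X $$ s) $$ p)"
    have T: "?T \<in> hermitian_mats d" "N ?T \<le> (\<Sum>s\<in>?S. N (H s (X $$ s)))"
      using mat_seminorm_sum[OF mat_subspace_hermitian N, of ?S "\<lambda>s. H s (X $$ s)"] H by simp_all
    have "map_mat (scaleR (1/2)) ?T = X"
      using hermitian_mats_carrier[OF X] by (intro eq_matI) (simp_all add: entries)
    moreover have "N (map_mat (scaleR (1/2)) ?T) = \<bar>1/2\<bar> * N ?T"
      using N T(1) unfolding mat_seminorm_def by blast
    ultimately have "N X = \<bar>1/2\<bar> * N ?T"
      by simp
    also have "\<dots> \<le> \<bar>1/2\<bar> * (\<Sum>s\<in>?S. N (H s (X $$ s)))"
      using T(2) by (intro mult_left_mono) auto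
    also have "\<dots> \<le> \<bar>1/2\<bar> * (\<Sum>s\<in>?S. C s * norm (X $$ s))"
      by (intro mult_left_mono sum_mono C) auto
    also have "\<dots> \<le> \<bar>1/2\<bar> * ((\<Sum>s\<in>?S. \<bar>C s\<bar>) * (\<Sum>s\<in>?S. norm (X $$ s)))"
      by (intro mult_left_mono sum_mult_le_sum_abs_mult_sum) auto
    also have "(\<Sum>s\<in>?S. norm (X $$ s)) = entry_norm d X"
      by (simp add: entry_norm_def sum.cartesian_product case_prod_unfold)
    finally show ?thesis
      by simp
  qed
  then show ?thesis
    by blast
qed

lemma diagonal_seminorm_bounded:
  assumes N: "mat_seminorm (diagonal_mats d) N"
  shows "\<exists>C. \<forall>X\<in>diagonal_mats d. N X \<le> C * entry_norm d X"
proof -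
  define E :: "nat \<Rightarrow> real mat" where
    "E i = mat d d (\<lambda>(p, q). if p = i \<and> q = i then 1 else 0)" for i
  have E: "E i \<in> diagonal_mats d" for i
    by (auto simp: E_def diagonal_mats_def diagonal_mat_def)
  then have cE: "map_mat (scaleR c) (E i) \<in> diagonal_mats d" for c i
    using mat_subspace_diagonal[of d] unfolding mat_subspace_def by simp
  have "N X \<le> (\<Sum>i<d. \<bar>N (E i)\<bar>) * entry_norm d X" if X: "X \<in> diagonal_mats d" for X
  proof -
    let ?M = "\<lambda>i. map_mat (scaleR (X $$ (i, i))) (E i)"
    have "(\<Sum>i<d. ?M i $$ (p, q)) = X $$ (p, q)" if "p < d" "q < d" for p q
    proof -
      have "(\<Sum>i<d. ?M i $$ (p, q)) = (\<Sum>i<d. if i = p then (if p = q then X $$ (i, i) else 0) else 0)"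
        using that by (intro sum.cong) (auto simp: E_def)
      also have "\<dots> = X $$ (p, q)"
        using that X by (auto simp: diagonal_mats_def diagonal_mat_def)
      finally show ?thesis .
    qed
    then have X_eq: "mat d d (\<lambda>p. \<Sum>i<d. ?M i $$ p) = X"
      using X by (intro eq_matI) (auto simp: diagonal_mats_def)
    have "N X \<le> (\<Sum>i<d. N (?M i))"
      using mat_seminorm_sum[OF mat_subspace_diagonal N, of "{..<d}" ?M]
      unfolding X_eq by (simp only: cE finite_lessThan simp_thms)
    also have "\<dots> = (\<Sum>i<d. N (E i) * norm (X $$ (i, i)))"
      using N E by (simp add: mat_seminorm_def mult.commute)
    also have "\<dots> \<le> (\<Sum>i<d. \<bar>N (E i)\<bar>) * (\<Sum>i<d. norm (X $$ (i, i)))"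
      by (intro sum_mult_le_sum_abs_mult_sum) auto
    also have "\<dots> \<le> (\<Sum>i<d. \<bar>N (E i)\<bar>) * entry_norm d X"
    proof (intro mult_left_mono sum_nonneg)
      show "(\<Sum>i<d. norm (X $$ (i, i))) \<le> entry_norm d X"
        unfolding entry_norm_def
      proof (rule sum_mono)
        show "norm (X $$ (i, i)) \<le> (\<Sum>j<d. norm (X $$ (i, j)))" if "i \<in> {..<d}" for i
          using that by (intro member_le_sum[of i _ "\<lambda>j. norm (X $$ (i, j))"]) auto
      qed
    qed simp
    finally show ?thesis .
  qed
  then show ?thesis
    by blast
qed


section \<open>Cones cut out by superlinear functions\<close>

lemma topspace_mat_topology: "topspace (mat_topology k) = carrier_mat k k"
  by (auto simp: mat_topology_def topspace_pullback_topology)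

lemma continuous_map_entry:
  assumes "i < k" "j < k"
  shows "continuous_map (mat_topology k) euclidean (\<lambda>A. A $$ (i, j))"
proof -
  have "continuous_map (mat_topology k) euclidean
      ((\<lambda>f. f (i, j)) \<circ> (\<lambda>A. \<lambda>ij\<in>{..<k} \<times> {..<k}. A $$ ij))"
    unfolding mat_topology_def
    using assms by (intro continuous_map_pullback continuous_map_product_projection) auto
  then show ?thesis
    using assms by (simp add: o_def)
qed

lemma openin_entry_norm_ball:
  "openin (mat_topology k) {A \<in> carrier_mat k k. C * entry_norm k (A - B) < e}"
  if B: "B \<in> carrier_mat k k" for B :: "'a::real_normed_vector mat"
proof -
  have "continuous_map (mat_topology k) euclidean (\<lambda>A. norm (A $$ (i, j) - B $$ (i, j)))"
    if "i < k" "j < k" for i j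
  proof -
    have "continuous_map euclidean euclidean (\<lambda>a. norm (a - B $$ (i, j)))"
      by (auto intro!: continuous_intros)
    from continuous_map_compose[OF continuous_map_entry[OF that] this] show ?thesis
      by (simp add: o_def)
  qed
  then have "continuous_map (mat_topology k) euclidean
      (\<lambda>A. C * (\<Sum>i<k. \<Sum>j<k. norm (A $$ (i, j) - B $$ (i, j))))"
    by (intro continuous_map_real_mult continuous_map_sum continuous_map_const[THEN iffD2]) auto
  then have "openin (mat_topology k)
      {A \<in> carrier_mat k k. C * (\<Sum>i<k. \<Sum>j<k. norm (A $$ (i, j) - B $$ (i, j))) \<in> {..<e}}"
    unfolding topspace_mat_topology[symmetric]
    by (rule openin_continuous_map_preimage) auto
  moreover have "entry_norm k (A - B) = (\<Sum>i<k. \<Sum>j<k. norm (A $$ (i, j) - B $$ (i, j)))"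
    if "A \<in> carrier_mat k k" for A
    using that B unfolding entry_norm_def by (intro sum.cong) auto
  ultimately show ?thesis
    by (simp cong: conj_cong)
qed

lemma diff_mem_mat_subspace:
  assumes V: "mat_subspace k V" and A: "A \<in> V" and B: "B \<in> V"
  shows "A - B \<in> V" "B + (A - B) = A"
proof -
  have c: "A \<in> carrier_mat k k" "B \<in> carrier_mat k k"
    using assms by (auto simp: mat_subspace_def)
  then have "A - B = A + map_mat (scaleR (-1)) B"
    by (intro eq_matI) auto
  then show "A - B \<in> V"
    using V A B by (simp add: mat_subspace_def)
  show "B + (A - B) = A"
    using c by (intro eq_matI) auto
qed

text \<open>
  Superadditivity turns the one-sided bound on \<open>F\<close> into a Lipschitz estimate for the entrywise
  distance, because \<open>F A \<ge> F B + F (A - B)\<close> and the roles of \<open>A\<close> and \<open>B\<close> can be exchanged. Hence \<open>F\<close> is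
  continuous, \<open>{F \<ge> 0}\<close> is closed, and the open set \<open>{F > 0}\<close> lies inside it.
\<close>

lemma convex_proper_cone_superlevel:
  fixes F :: "'a::star_algebra mat \<Rightarrow> real"
  assumes V: "mat_subspace k V"
    and scale: "\<And>A c. A \<in> V \<Longrightarrow> 0 \<le> c \<Longrightarrow> F (map_mat (scaleR c) A) = c * F A"
    and superadd: "\<And>A B. A \<in> V \<Longrightarrow> B \<in> V \<Longrightarrow> F A + F B \<le> F (A + B)"
    and bound: "\<And>A. A \<in> V \<Longrightarrow> - F A \<le> C * entry_norm k A"
    and pointed: "\<And>A. A \<in> V \<Longrightarrow> - A \<in> V \<Longrightarrow> 0 \<le> F A \<Longrightarrow> 0 \<le> F (- A) \<Longrightarrow> A = 0\<^sub>m k k"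
    and inner: "A\<^sub>0 \<in> V" "0 < F A\<^sub>0"
  shows "convex_proper_cone k V {A \<in> V. 0 \<le> F A}"
proof -
  let ?T = "subtopology (mat_topology k) V"
  have carrier: "V \<subseteq> carrier_mat k k"
    using V by (simp add: mat_subspace_def)
  have top: "topspace ?T = V"
    using carrier by (auto simp: topspace_mat_topology)
  have ball: "openin ?T {A \<in> V. C * entry_norm k (A - B) < e}" if "B \<in> V" for B e
  proof -
    have "{A \<in> V. C * entry_norm k (A - B) < e} = {A \<in> carrier_mat k k. C * entry_norm k (A - B) < e} \<inter> V"
      using carrier by auto
    moreover have "openin (mat_topology k) {A \<in> carrier_mat k k. C * entry_norm k (A - B) < e}"
      using that carrier by (intro openin_entry_norm_ball) auto
    ultimately show ?thesis
      by (simp only: openin_subtopology_Int)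
  qed
  have sym: "entry_norm k (A - B) = entry_norm k (B - A)" if "A \<in> V" "B \<in> V" for A B
  proof -
    have "A \<in> carrier_mat k k" "B \<in> carrier_mat k k"
      using that carrier by auto
    then show ?thesis
      unfolding entry_norm_def by (intro sum.cong refl) (simp add: norm_minus_commute)
  qed
  have lipschitz: "\<bar>F A - F B\<bar> \<le> C * entry_norm k (A - B)" if "A \<in> V" "B \<in> V" for A B
  proof -
    have "F Y - F X \<le> C * entry_norm k (X - Y)" if "X \<in> V" "Y \<in> V" for X Y
      using superadd[of Y "X - Y"] bound[of "X - Y"] diff_mem_mat_subspace[OF V that] that by simp
    from this[of A B] this[of B A] show ?thesis
      using that sym by (simp add: abs_le_iff)
  qed
  have cont: "continuous_map ?T euclidean F"
    unfolding continuous_map top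
  proof (intro conjI allI impI)
    fix U :: "real set" assume "openin euclidean U"
    then have U: "open U" by simp
    show "openin ?T {A \<in> V. F A \<in> U}"
    proof (subst openin_subopen, safe)
      fix B assume B: "B \<in> V" "F B \<in> U"
      then obtain e where e: "0 < e" "\<And>y. dist y (F B) < e \<Longrightarrow> y \<in> U"
        using U by (meson open_dist)
      let ?W = "{A \<in> V. C * entry_norm k (A - B) < e}"
      have "B \<in> ?W"
        using B(1) e(1) carrier by (auto simp: entry_norm_def)
      moreover have "?W \<subseteq> {A \<in> V. F A \<in> U}"
        using e(2) lipschitz[OF _ B(1)] by (fastforce simp: dist_real_def)
      ultimately show "\<exists>T. openin ?T T \<and> B \<in> T \<and> T \<subseteq> {A \<in> V. F A \<in> U}"
        using ball[OF B(1)] by blast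
    qed
  qed simp
  have "closedin ?T {A \<in> V. 0 \<le> F A}"
    using closedin_continuous_map_preimage[OF cont, of "{0..}"] unfolding top by simp
  moreover have "A\<^sub>0 \<in> ?T interior_of {A \<in> V. 0 \<le> F A}"
  proof -
    have "openin ?T {A \<in> V. 0 < F A}"
      using openin_continuous_map_preimage[OF cont, of "{0<..}"] unfolding top by simp
    then have "{A \<in> V. 0 < F A} \<subseteq> ?T interior_of {A \<in> V. 0 \<le> F A}"
      by (intro interior_of_maximal) auto
    then show ?thesis
      using inner by auto
  qed
  moreover have "map_mat (scaleR (1 - u)) A + map_mat (scaleR u) B \<in> V \<and>
      0 \<le> F (map_mat (scaleR (1 - u)) A + map_mat (scaleR u) B)"
    if "A \<in> V" "0 \<le> F A" "B \<in> V" "0 \<le> F B" "0 \<le> u" "u \<le> 1" for A B u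
  proof -
    have mem: "map_mat (scaleR (1 - u)) A \<in> V" "map_mat (scaleR u) B \<in> V"
      using V that by (auto simp: mat_subspace_def)
    have "0 \<le> (1 - u) * F A + u * F B"
      using that by simp
    also have "\<dots> \<le> F (map_mat (scaleR (1 - u)) A + map_mat (scaleR u) B)"
      using superadd[OF mem] scale that by simp
    finally show ?thesis
      using V mem by (auto simp: mat_subspace_def)
  qed
  moreover have "map_mat (scaleR c) A \<in> V" if "A \<in> V" for A c
    using V that by (auto simp: mat_subspace_def)
  ultimately show ?thesis
    unfolding convex_proper_cone_def using scale pointed by auto
qed


section \<open>Bordered matrices\<close>

abbreviation bordered :: "real \<Rightarrow> 'a::star_algebra mat \<Rightarrow> 'a mat" where
  "bordered t X \<equiv> diag_block_mat [real_block t, X]"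

lemma bordered_carrier: "X \<in> carrier_mat n n \<Longrightarrow> bordered t X \<in> carrier_mat (Suc n) (Suc n)"
  by (auto simp: real_block_def Let_def)

lemma bordered_index:
  assumes "X \<in> carrier_mat n n"
  shows "bordered t X $$ (0, 0) = t *\<^sub>R 1"
    and "j < n \<Longrightarrow> bordered t X $$ (0, Suc j) = 0"
    and "i < n \<Longrightarrow> bordered t X $$ (Suc i, 0) = 0"
    and "i < n \<Longrightarrow> j < n \<Longrightarrow> bordered t X $$ (Suc i, Suc j) = X $$ (i, j)"
  using assms by (auto simp: real_block_def Let_def)

declare diag_block_mat.simps [simp del]

text \<open>
  An identity between bordered matrices, such as \<open>truncate_bordered\<close>, is checked on the corner, the
  border and the block separately.
\<close>

lemma eq_bordered_iff:
  assumes X: "X \<in> carrier_mat n n" and A: "A \<in> carrier_mat (Suc n) (Suc n)"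
  shows "A = bordered t X \<longleftrightarrow> A $$ (0, 0) = t *\<^sub>R 1 \<and>
    (\<forall>i<n. A $$ (0, Suc i) = 0 \<and> A $$ (Suc i, 0) = 0 \<and> (\<forall>j<n. A $$ (Suc i, Suc j) = X $$ (i, j)))"
    (is "_ \<longleftrightarrow> ?R")
proof
  assume R: ?R
  have B: "bordered t X \<in> carrier_mat (Suc n) (Suc n)"
    by (rule bordered_carrier[OF X])
  show "A = bordered t X"
  proof (rule eq_matI)
    fix i j assume "i < dim_row (bordered t X)" "j < dim_col (bordered t X)"
    then have "i < Suc n" "j < Suc n"
      using B by auto
    then show "A $$ (i, j) = bordered t X $$ (i, j)"
      using R by (cases i; cases j) (simp_all add: bordered_index[OF X])
  qed (use A B in auto)
qed (use bordered_index[OF X] in auto)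

lemma bordered_inject:
  assumes "bordered t X = bordered s (Y :: 'a::hypercomplex mat)" "X \<in> carrier_mat n n" "Y \<in> carrier_mat n n"
  shows "t = s" "X = Y"
proof -
  note * = iffD1[OF eq_bordered_iff[OF assms(3) bordered_carrier[OF assms(2)]] assms(1)]
  then show "t = s"
    using bordered_index(1)[OF assms(2), of t] by simp
  show "X = Y"
    using * assms(2,3) bordered_index(4)[OF assms(2), of _ _ t] by (intro eq_matI) auto
qed

lemma bordered_add:
  assumes "X \<in> carrier_mat n n" "Y \<in> carrier_mat n n"
  shows "bordered t X + bordered s Y = bordered (t + s) (X + Y)"
  using assms bordered_carrier[OF assms(1), of t] bordered_carrier[OF assms(2), of s]
  by (subst eq_bordered_iff[of _ n]) (auto simp: bordered_index scaleR_add_left)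

lemma bordered_scaleR:
  assumes "X \<in> carrier_mat n n"
  shows "map_mat (scaleR c) (bordered t X) = bordered (c * t) (map_mat (scaleR c) X)"
  using assms bordered_carrier[OF assms, of t]
  by (subst eq_bordered_iff[of _ n]) (auto simp: bordered_index)

lemma bordered_zero: "0\<^sub>m (Suc n) (Suc n) = bordered 0 (0\<^sub>m n n)"
  by (subst eq_bordered_iff[of _ n]) auto

text \<open>With an empty block this makes the one-dimensional norm cone an instance of the general shape.\<close>

lemma bordered_empty: "X \<in> carrier_mat 0 0 \<Longrightarrow> bordered t X = real_block t"
  by (rule sym, subst eq_bordered_iff[of _ 0]) (auto simp: real_block_def)

lemma entry_norm_bordered:
  fixes X :: "'a::star_algebra mat"
  assumes "X \<in> carrier_mat n n"
  shows "entry_norm (Suc n) (bordered t X) = \<bar>t\<bar> * norm (1 :: 'a) + entry_norm n X"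
  unfolding entry_norm_def using assms
  by (simp add: sum.lessThan_Suc_shift bordered_index del: sum.lessThan_Suc cong: sum.cong_simp)


section \<open>Truncation and lift of bordered matrices\<close>

lemma increasing_seqs_nth_less: "is \<in> increasing_seqs d k \<Longrightarrow> p < k \<Longrightarrow> is ! p < d"
  by (auto simp: increasing_seqs_def dest!: nth_mem)

text \<open>
  For \<open>m = 0\<close> the only increasing sequence is the empty one, which yields the exceptional index set
  \<open>{[0]}\<close>.
\<close>

lemma soc_index_Suc: "soc_index (Suc n) (Suc m) = (\<lambda>js. 0 # map Suc js) ` increasing_seqs n m"
proof (intro equalityI subsetI)
  fix "is" assume "is \<in> soc_index (Suc n) (Suc m)"
  then obtain js where is_eq: "is = 0 # js" and js: "length js = m" "sorted_wrt (<) js" "set js \<subseteq> {1..<Suc n}"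
    by (auto simp: soc_index_def split: if_splits)
  let ?js = "map (\<lambda>j. j - 1) js"
  have pos: "j = Suc (j - 1)" if "j \<in> set js" for j
    using js(3) that by auto
  then have "map Suc ?js = js"
    by (simp add: o_def map_idI)
  moreover have "x - 1 < y - 1" if "x \<in> set js" "y \<in> set js" "x < y" for x y
    using pos[OF that(1)] pos[OF that(2)] that(3) by linarith
  then have "sorted_wrt (<) ?js"
    unfolding sorted_wrt_map using js(2) by (rule sorted_wrt_mono_rel)
  moreover have "set ?js \<subseteq> {..<n}"
    using js(3) by force
  ultimately show "is \<in> (\<lambda>js. 0 # map Suc js) ` increasing_seqs n m"
    using js(1) is_eq by (intro image_eqI[of _ _ ?js]) (auto simp: increasing_seqs_def)
qed (auto simp: soc_index_def increasing_seqs_def sorted_wrt_map subset_eq)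

lemma border_index_increasing: "js \<in> increasing_seqs n m \<Longrightarrow> 0 # map Suc js \<in> increasing_seqs (Suc n) (Suc m)"
  by (auto simp: increasing_seqs_def sorted_wrt_map)

lemma truncate_carrier: "is \<in> increasing_seqs d k \<Longrightarrow> truncate is X \<in> carrier_mat k k"
  by (simp add: truncate_def increasing_seqs_def)

lemma lift_carrier: "lift d is X \<in> carrier_mat d d"
  by (simp add: lift_def)

lemma truncate_lift:
  assumes "is \<in> increasing_seqs d k" "X \<in> carrier_mat k k"
  shows "truncate is (lift d is X) = X"
proof -
  have "length is = k"
    using assms(1) by (simp add: increasing_seqs_def)
  then show ?thesis
    using assms(2) by (intro eq_matI) (auto simp: truncate_def lift_index[OF assms(1)])
qed

text \<open>
  The next two lemmas reduce the embedding property to conditions on the blocks: operations along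
  \<open>0 # map Suc js\<close> do not touch the corner and act on the block along \<open>js\<close>.
\<close>

lemma truncate_bordered:
  assumes js: "js \<in> increasing_seqs n m" and X: "X \<in> carrier_mat n n"
  shows "truncate (0 # map Suc js) (bordered t X) = bordered t (truncate js X)"
  using js truncate_carrier[OF js, of X]
    truncate_carrier[OF border_index_increasing[OF js], of "bordered t X"]
    increasing_seqs_nth_less[OF js]
  by (subst eq_bordered_iff[of _ m])
    (auto simp: truncate_def bordered_index[OF X] increasing_seqs_def)

lemma lift_bordered:
  assumes js: "js \<in> increasing_seqs n m" and X: "X \<in> carrier_mat m m"
  shows "lift (Suc n) (0 # map Suc js) (bordered t X) = bordered t (lift n js X)"
proof (subst eq_bordered_iff[OF lift_carrier lift_carrier], intro conjI allI impI)
  let ?is = "0 # map Suc js" and ?B = "bordered t X"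
  note index = lift_index[OF border_index_increasing[OF js], of _ _ ?B]
  have len: "length js = m"
    using js by (simp add: increasing_seqs_def)
  show "lift (Suc n) ?is ?B $$ (0, 0) = t *\<^sub>R 1"
    using index[of 0 0] by (simp add: bordered_index[OF X])
  fix i assume i: "i < n"
  show "lift (Suc n) ?is ?B $$ (0, Suc i) = 0"
  proof (cases "i \<in> set js")
    case True
    then obtain p where "p < m" "i = js ! p"
      using len by (metis in_set_conv_nth)
    then show ?thesis
      using index[of 0 "Suc p"] len by (simp add: bordered_index[OF X])
  next
    case False
    then show ?thesis
      using i by (intro lift_index_outside) auto
  qed
  show "lift (Suc n) ?is ?B $$ (Suc i, 0) = 0"
  proof (cases "i \<in> set js")
    case True
    then obtain p where "p < m" "i = js ! p"
      using len by (metis in_set_conv_nth)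
    then show ?thesis
      using index[of "Suc p" 0] len by (simp add: bordered_index[OF X])
  next
    case False
    then show ?thesis
      using i by (intro lift_index_outside) auto
  qed
  fix j assume j: "j < n"
  show "lift (Suc n) ?is ?B $$ (Suc i, Suc j) = lift n js X $$ (i, j)"
  proof (cases "i \<in> set js \<and> j \<in> set js")
    case True
    then obtain p q where "p < m" "i = js ! p" "q < m" "j = js ! q"
      using len by (metis in_set_conv_nth)
    then show ?thesis
      using index[of "Suc p" "Suc q"] lift_index[OF js, of p q X] len by (simp add: bordered_index[OF X])
  next
    case False
    then have "lift (Suc n) ?is ?B $$ (Suc i, Suc j) = 0"
      using i j by (intro lift_index_outside) auto
    moreover have "lift n js X $$ (i, j) = 0"
      using False i j by (intro lift_index_outside) auto
    ultimately show ?thesis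
      by simp
  qed
qed

lemma truncate_hermitian:
  assumes "is \<in> increasing_seqs d k" "X \<in> hermitian_mats d"
  shows "truncate is X \<in> hermitian_mats k"
  using assms(1) increasing_seqs_nth_less[OF assms(1)] hermitian_mats_conjugate[OF assms(2)]
  by (intro hermitian_matsI truncate_carrier) (auto simp: truncate_def increasing_seqs_def)

lemma truncate_diagonal:
  assumes js: "is \<in> increasing_seqs d k" and "X \<in> diagonal_mats d"
  shows "truncate is X \<in> diagonal_mats k"
proof -
  have "distinct is" "length is = k"
    using js by (auto simp: increasing_seqs_def strict_sorted_iff)
  then show ?thesis
    using assms(2) increasing_seqs_nth_less[OF js]
    by (auto simp: diagonal_mats_def diagonal_mat_def truncate_def nth_eq_iff_index_eq)
qed

lemma lift_cases:
  assumes "is \<in> increasing_seqs d k" "i < d" "j < d"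
  obtains (inside) p q where "p < k" "q < k" "i = is ! p" "j = is ! q"
  | (outside) "i \<notin> set is \<or> j \<notin> set is"
  using assms by (metis (mono_tags, lifting) in_set_conv_nth increasing_seqs_def mem_Collect_eq)

lemma lift_hermitian:
  fixes X :: "'a::hypercomplex mat"
  assumes js: "is \<in> increasing_seqs d k" and X: "X \<in> hermitian_mats k"
  shows "lift d is X \<in> hermitian_mats d"
proof (intro hermitian_matsI lift_carrier)
  fix i j assume ij: "i < d" "j < d"
  from js ij show "lift d is X $$ (i, j) = conjugate (lift d is X $$ (j, i))"
  proof (cases rule: lift_cases)
    case (inside p q)
    then show ?thesis
      using hermitian_mats_conjugate[OF X] by (simp add: lift_index[OF js])
  next
    case outside
    then have "lift d is X $$ (i, j) = 0" "lift d is X $$ (j, i) = 0"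
      using ij by (auto intro: lift_index_outside)
    then show ?thesis
      by simp
  qed
qed

lemma lift_diagonal:
  assumes js: "is \<in> increasing_seqs d k" and X: "X \<in> diagonal_mats k"
  shows "lift d is X \<in> diagonal_mats d"
proof -
  have "lift d is X $$ (i, j) = 0" if ij: "i < d" "j < d" "i \<noteq> j" for i j
    using js ij(1,2)
  proof (cases rule: lift_cases)
    case (inside p q)
    then have "p \<noteq> q"
      using ij(3) by auto
    then show ?thesis
      using X inside by (auto simp: lift_index[OF js] diagonal_mats_def diagonal_mat_def)
  next
    case outside
    then show ?thesis
      using ij by (auto intro: lift_index_outside)
  qed
  then show ?thesis
    by (auto simp: diagonal_mats_def diagonal_mat_def lift_carrier lift_def)
qed


section \<open>Norm cones\<close>

text \<open>
  A norm on the spaces is unconstrained at the empty matrix. Fixing the value \<open>0\<close> there lets the cone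
  of size \<open>1\<close> and the index sequence \<open>[0]\<close> be treated like all others.
\<close>

definition zero_ext :: "('a mat \<Rightarrow> real) \<Rightarrow> 'a mat \<Rightarrow> real" where
  "zero_ext nrm X = (if dim_row X = 0 then 0 else nrm X)"

locale matrix_spaces =
  fixes L :: "nat \<Rightarrow> 'a::hypercomplex mat set"
  assumes subspace: "mat_subspace d (L d)"
    and mat_seminorm_bounded: "mat_seminorm (L d) N \<Longrightarrow> \<exists>C. \<forall>X\<in>L d. N X \<le> C * entry_norm d X"
    and truncate_closed: "is \<in> increasing_seqs d k \<Longrightarrow> X \<in> L d \<Longrightarrow> truncate is X \<in> L k"
    and lift_closed: "is \<in> increasing_seqs d k \<Longrightarrow> X \<in> L k \<Longrightarrow> lift d is X \<in> L d"
begin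

lemma carrier: "X \<in> L d \<Longrightarrow> X \<in> carrier_mat d d"
  using subspace[of d] by (auto simp: mat_subspace_def)

lemma L_0: "L 0 = {0\<^sub>m 0 0}"
proof -
  have "X = 0\<^sub>m 0 0" if "X \<in> L 0" for X
    using carrier[OF that] by (intro eq_matI) auto
  then show ?thesis
    using subspace[of 0] by (auto simp: mat_subspace_def)
qed

lemma norm_cone_Suc: "norm_cone L nrm (Suc n) = {bordered t X | t X. X \<in> L n \<and> zero_ext nrm X \<le> t}"
proof (cases n)
  case 0
  then show ?thesis
    by (auto simp: norm_cone_def zero_ext_def L_0 bordered_empty)
next
  case (Suc m)
  then show ?thesis
    using carrier by (fastforce simp: norm_cone_def zero_ext_def)
qed

lemma norm_cone_space_Suc: "norm_cone_space L (Suc n) = {bordered t X | t X. X \<in> L n}"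
  by (cases n) (auto simp: norm_cone_space_def L_0 bordered_empty)

lemma bordered_mem_norm_cone_iff:
  assumes "X \<in> L n"
  shows "bordered t X \<in> norm_cone L nrm (Suc n) \<longleftrightarrow> zero_ext nrm X \<le> t"
proof
  assume "bordered t X \<in> norm_cone L nrm (Suc n)"
  then obtain s Y where eq: "bordered t X = bordered s Y" and Y: "Y \<in> L n" and "zero_ext nrm Y \<le> s"
    unfolding norm_cone_Suc by blast
  then show "zero_ext nrm X \<le> t"
    using bordered_inject[OF eq carrier[OF assms] carrier[OF Y]] by simp
next
  assume "zero_ext nrm X \<le> t"
  then show "bordered t X \<in> norm_cone L nrm (Suc n)"
    using assms unfolding norm_cone_Suc by blast
qed

lemma bordered_mem_norm_cone_space: "X \<in> L n \<Longrightarrow> bordered t X \<in> norm_cone_space L (Suc n)"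
  unfolding norm_cone_space_Suc by blast

lemma norm_cone_space_cases:
  assumes "A \<in> norm_cone_space L (Suc n)"
  obtains t X where "A = bordered t X" "X \<in> L n"
  using assms unfolding norm_cone_space_Suc by blast

lemma add_closed: "X \<in> L n \<Longrightarrow> Y \<in> L n \<Longrightarrow> X + Y \<in> L n"
  and scaleR_closed: "X \<in> L n \<Longrightarrow> map_mat (scaleR c) X \<in> L n"
  and zero_closed: "0\<^sub>m n n \<in> L n"
  using subspace[of n] by (auto simp: mat_subspace_def)

lemma mat_subspace_norm_cone_space: "mat_subspace (Suc n) (norm_cone_space L (Suc n))"
  unfolding mat_subspace_def
proof (intro conjI ballI allI subsetI)
  show "0\<^sub>m (Suc n) (Suc n) \<in> norm_cone_space L (Suc n)"
    unfolding bordered_zero by (intro bordered_mem_norm_cone_space zero_closed)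
next
  fix A assume "A \<in> norm_cone_space L (Suc n)"
  then obtain t X where A: "A = bordered t X" "X \<in> L n"
    by (rule norm_cone_space_cases)
  show "A \<in> carrier_mat (Suc n) (Suc n)"
    unfolding A(1) by (rule bordered_carrier[OF carrier[OF A(2)]])
  show "map_mat (scaleR c) A \<in> norm_cone_space L (Suc n)" for c
    unfolding A(1) bordered_scaleR[OF carrier[OF A(2)]]
    by (intro bordered_mem_norm_cone_space scaleR_closed A(2))
  fix B assume "B \<in> norm_cone_space L (Suc n)"
  then obtain s Y where B: "B = bordered s Y" "Y \<in> L n"
    by (rule norm_cone_space_cases)
  show "A + B \<in> norm_cone_space L (Suc n)"
    unfolding A(1) B(1) bordered_add[OF carrier[OF A(2)] carrier[OF B(2)]]
    by (intro bordered_mem_norm_cone_space add_closed A(2) B(2))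
qed

end

locale normed_matrix_spaces = matrix_spaces L for L :: "nat \<Rightarrow> 'a::hypercomplex mat set" +
  fixes nrm :: "'a mat \<Rightarrow> real"
  assumes norm: "norm_on_spaces L nrm"
begin

abbreviation N :: "'a mat \<Rightarrow> real" where "N \<equiv> zero_ext nrm"

lemma N_eq: "1 \<le> d \<Longrightarrow> X \<in> carrier_mat d d \<Longrightarrow> N X = nrm X"
  by (auto simp: zero_ext_def)

lemma N_seminorm: "mat_seminorm (L n) N"
proof (cases "n = 0")
  case True
  then show ?thesis
    by (simp add: mat_seminorm_def L_0 zero_ext_def)
next
  case False
  then have n: "1 \<le> n"
    by simp
  then show ?thesis
    using norm by (simp add: mat_seminorm_def norm_on_spaces_def N_eq[OF n carrier] add_closed scaleR_closed)
qed

lemma N_nonneg: "X \<in> L n \<Longrightarrow> 0 \<le> N X"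
  and N_eq_0: "X \<in> L n \<Longrightarrow> N X = 0 \<Longrightarrow> X = 0\<^sub>m n n"
proof -
  assume X: "X \<in> L n"
  have "0 \<le> N X \<and> (N X = 0 \<longrightarrow> X = 0\<^sub>m n n)"
  proof (cases "n = 0")
    case True
    then show ?thesis
      using X by (simp add: L_0 zero_ext_def)
  next
    case False
    then have n: "1 \<le> n"
      by simp
    then show ?thesis
      using norm X by (simp add: norm_on_spaces_def N_eq[OF n carrier])
  qed
  then show "0 \<le> N X" "N X = 0 \<Longrightarrow> X = 0\<^sub>m n n"
    by simp_all
qed

text \<open>
  The norm cone is the superlevel set of \<open>diag(t, X) \<mapsto> t - N X\<close>, which is superlinear as \<open>N\<close> is
  sublinear; the bounds of \<open>N\<close> by the entries of \<open>X\<close> and of \<open>t\<close> by the corner entry \<open>t 1\<close> combine to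
  the required estimate.
\<close>

lemma convex_proper_cone_norm_cone:
  "convex_proper_cone (Suc n) (norm_cone_space L (Suc n)) (norm_cone L nrm (Suc n))"
proof -
  \<comment> \<open>The corner \<open>t\<close> is recovered from the scalar \<open>t 1\<close> by injectivity, as \<open>1 \<noteq> 0\<close>.\<close>
  define F where "F A = the_inv (\<lambda>t. t *\<^sub>R (1 :: 'a)) (A $$ (0, 0)) - N (mat n n (\<lambda>(i, j). A $$ (Suc i, Suc j)))" for A
  have F: "F (bordered t X) = t - N X" if "X \<in> L n" for t X
  proof -
    have "inj (\<lambda>t. t *\<^sub>R (1 :: 'a))"
      by (auto intro: injI)
    note the_inv_f_f[OF this, of t]
    moreover have "mat n n (\<lambda>(i, j). bordered t X $$ (Suc i, Suc j)) = X"
      using carrier[OF that] by (intro eq_matI) (auto simp: bordered_index[OF carrier[OF that]])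
    ultimately show ?thesis
      by (simp add: F_def bordered_index(1)[OF carrier[OF that]])
  qed
  let ?V = "norm_cone_space L (Suc n)"
  obtain C where C: "\<And>X. X \<in> L n \<Longrightarrow> N X \<le> C * entry_norm n X"
    using mat_seminorm_bounded[OF N_seminorm] by blast
  have "convex_proper_cone (Suc n) ?V {A \<in> ?V. 0 \<le> F A}"
  proof (rule convex_proper_cone_superlevel[OF mat_subspace_norm_cone_space, of n F])
    fix A and c :: real assume "A \<in> ?V" "0 \<le> c"
    then obtain t X where "A = bordered t X" "X \<in> L n"
      by (blast elim: norm_cone_space_cases)
    then show "F (map_mat (scaleR c) A) = c * F A"
      using N_seminorm \<open>0 \<le> c\<close>
      by (simp add: F scaleR_closed bordered_scaleR[OF carrier] mat_seminorm_def right_diff_distrib)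
  next
    fix A B assume "A \<in> ?V" "B \<in> ?V"
    then obtain t X s Y where "A = bordered t X" "X \<in> L n" "B = bordered s Y" "Y \<in> L n"
      by (blast elim: norm_cone_space_cases)
    moreover from this have "N (X + Y) \<le> N X + N Y"
      using N_seminorm by (auto simp: mat_seminorm_def)
    ultimately show "F A + F B \<le> F (A + B)"
      by (simp add: F add_closed bordered_add[OF carrier carrier])
  next
    fix A assume "A \<in> ?V"
    then obtain t X where A: "A = bordered t X" "X \<in> L n"
      by (blast elim: norm_cone_space_cases)
    have e: "0 \<le> entry_norm n X"
      by (auto simp: entry_norm_def intro!: sum_nonneg)
    have "- F A \<le> \<bar>C\<bar> * entry_norm n X + \<bar>t\<bar>"
      using C[OF A(2)] mult_right_mono[OF abs_ge_self[of C] e] by (simp add: A F)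
    also have "\<dots> \<le> (\<bar>C\<bar> + 1 / norm (1::'a)) * (\<bar>t\<bar> * norm (1 :: 'a) + entry_norm n X)"
      using e by (simp add: field_simps)
    finally show "- F A \<le> (\<bar>C\<bar> + 1 / norm (1::'a)) * entry_norm (Suc n) A"
      by (simp add: A entry_norm_bordered[OF carrier])
  next
    fix A assume "A \<in> ?V" "- A \<in> ?V" "0 \<le> F A" "0 \<le> F (- A)"
    then obtain t X where A: "A = bordered t X" "X \<in> L n"
      by (blast elim: norm_cone_space_cases)
    have "- A = map_mat (scaleR (-1)) A"
      by (intro eq_matI) auto
    also have "\<dots> = bordered (- t) (map_mat (scaleR (-1)) X)"
      using bordered_scaleR[OF carrier[OF A(2)], of "-1" t] by (simp add: A)
    finally have "0 \<le> - t - N X"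
      using \<open>0 \<le> F (- A)\<close> A(2) N_seminorm by (simp add: F scaleR_closed mat_seminorm_def)
    moreover have "0 \<le> t - N X"
      using \<open>0 \<le> F A\<close> A by (simp add: F)
    ultimately have "t = 0" "N X = 0"
      using N_nonneg[OF A(2)] by auto
    then show "A = 0\<^sub>m (Suc n) (Suc n)"
      using N_eq_0[OF A(2)] A(1) by (simp add: bordered_zero)
  next
    show "bordered 1 (0\<^sub>m n n) \<in> ?V"
      by (rule bordered_mem_norm_cone_space[OF zero_closed])
    show "0 < F (bordered 1 (0\<^sub>m n n))"
      using mat_seminorm_zero[OF subspace N_seminorm, of n] by (simp add: F zero_closed)
  qed
  moreover have "{A \<in> ?V. 0 \<le> F A} = norm_cone L nrm (Suc n)"
  proof (intro equalityI subsetI)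
    fix A assume "A \<in> {A \<in> ?V. 0 \<le> F A}"
    then obtain t X where "A = bordered t X" "X \<in> L n" "0 \<le> F A"
      by (blast elim: norm_cone_space_cases)
    then show "A \<in> norm_cone L nrm (Suc n)"
      by (simp add: F bordered_mem_norm_cone_iff)
  next
    fix A assume "A \<in> norm_cone L nrm (Suc n)"
    then obtain t X where "A = bordered t X" "X \<in> L n" "N X \<le> t"
      unfolding norm_cone_Suc by blast
    then show "A \<in> {A \<in> ?V. 0 \<le> F A}"
      by (simp add: F bordered_mem_norm_cone_space)
  qed
  ultimately show ?thesis
    by simp
qed

lemma all_pos_nat_pairs:
  "(\<forall>d k. 1 \<le> k \<and> k \<le> d \<longrightarrow> P d k) \<longleftrightarrow> (\<forall>n m. m \<le> n \<longrightarrow> P (Suc n) (Suc m))" for P :: "nat \<Rightarrow> nat \<Rightarrow> bool"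
proof (intro iffI allI impI)
  fix d k :: nat assume "\<forall>n m. m \<le> n \<longrightarrow> P (Suc n) (Suc m)" "1 \<le> k \<and> k \<le> d"
  then show "P d k"
    by (cases d; cases k) auto
qed simp

text \<open>
  A condition of the form ``\<open>N X \<le> t\<close> implies \<open>N Y \<le> t\<close> for all \<open>t\<close>'' is the inequality \<open>N Y \<le> N X\<close>;
  this removes the corner from the embedding conditions.
\<close>

lemma embedding_property_iff:
  "embedding_property (norm_cone_space L) (norm_cone L nrm) soc_index \<longleftrightarrow>
    (\<forall>n m. m \<le> n \<longrightarrow> (\<forall>js\<in>increasing_seqs n m.
      (\<forall>X\<in>L n. N (truncate js X) \<le> N X) \<and> (\<forall>X\<in>L m. N (lift n js X) \<le> N X)))"
  (is "_ \<longleftrightarrow> ?R")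
proof -
  have truncate: "(\<forall>Z\<in>norm_cone L nrm (Suc n). truncate (0 # map Suc js) Z \<in> norm_cone L nrm (Suc m))
      \<longleftrightarrow> (\<forall>X\<in>L n. N (truncate js X) \<le> N X)" if js: "js \<in> increasing_seqs n m" for js n m
  proof -
    have "(\<forall>Z\<in>norm_cone L nrm (Suc n). truncate (0 # map Suc js) Z \<in> norm_cone L nrm (Suc m))
        \<longleftrightarrow> (\<forall>X\<in>L n. \<forall>t\<ge>N X. truncate (0 # map Suc js) (bordered t X) \<in> norm_cone L nrm (Suc m))"
      unfolding norm_cone_Suc[of nrm n] by blast
    also have "\<dots> \<longleftrightarrow> (\<forall>X\<in>L n. \<forall>t\<ge>N X. N (truncate js X) \<le> t)"
      using js by (simp add: truncate_bordered[OF _ carrier] bordered_mem_norm_cone_iff truncate_closed)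
    finally show ?thesis
      by (meson order_refl order_trans)
  qed
  have lift: "(\<forall>Z\<in>norm_cone L nrm (Suc m). lift (Suc n) (0 # map Suc js) Z \<in> norm_cone L nrm (Suc n))
      \<longleftrightarrow> (\<forall>X\<in>L m. N (lift n js X) \<le> N X)" if js: "js \<in> increasing_seqs n m" for js n m
  proof -
    have "(\<forall>Z\<in>norm_cone L nrm (Suc m). lift (Suc n) (0 # map Suc js) Z \<in> norm_cone L nrm (Suc n))
        \<longleftrightarrow> (\<forall>X\<in>L m. \<forall>t\<ge>N X. lift (Suc n) (0 # map Suc js) (bordered t X) \<in> norm_cone L nrm (Suc n))"
      unfolding norm_cone_Suc[of nrm m] by blast
    also have "\<dots> \<longleftrightarrow> (\<forall>X\<in>L m. \<forall>t\<ge>N X. N (lift n js X) \<le> t)"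
      using js by (simp add: lift_bordered[OF _ carrier] bordered_mem_norm_cone_iff lift_closed)
    finally show ?thesis
      by (meson order_refl order_trans)
  qed
  have "convex_proper_cone k (norm_cone_space L k) (norm_cone L nrm k)" if "1 \<le> k" for k
    using convex_proper_cone_norm_cone[of "k - 1"] that by simp
  then have "embedding_property (norm_cone_space L) (norm_cone L nrm) soc_index \<longleftrightarrow>
    (\<forall>d k. 1 \<le> k \<and> k \<le> d \<longrightarrow> (\<forall>is\<in>soc_index d k.
      (\<forall>Z\<in>norm_cone L nrm d. truncate is Z \<in> norm_cone L nrm k) \<and>
      (\<forall>X\<in>norm_cone L nrm k. lift d is X \<in> norm_cone L nrm d)))"
    by (simp add: embedding_property_def)
  also have "\<dots> \<longleftrightarrow> (\<forall>n m. m \<le> n \<longrightarrow> (\<forall>is\<in>soc_index (Suc n) (Suc m).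
      (\<forall>Z\<in>norm_cone L nrm (Suc n). truncate is Z \<in> norm_cone L nrm (Suc m)) \<and>
      (\<forall>X\<in>norm_cone L nrm (Suc m). lift (Suc n) is X \<in> norm_cone L nrm (Suc n))))"
    by (rule all_pos_nat_pairs)
  also have "\<dots> \<longleftrightarrow> ?R"
    by (simp add: soc_index_Suc truncate lift cong: ball_cong)
  finally show ?thesis .
qed

text \<open>
  Consistency speaks of lifts of truncations only, but every \<open>X\<close> is the truncation of its own lift.
  In the other direction the two inequalities between \<open>N (truncate X)\<close> and the norm of its lift come
  from the lift condition and from the truncation condition applied to that lift.
\<close>

lemma consistent_monotonic_iff:
  "consistent L nrm \<and> monotonic L nrm \<longleftrightarrow>
    (\<forall>n m. m \<le> n \<longrightarrow> (\<forall>js\<in>increasing_seqs n m.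
      (\<forall>X\<in>L n. N (truncate js X) \<le> N X) \<and> (\<forall>X\<in>L m. N (lift n js X) \<le> N X)))"
  (is "_ \<longleftrightarrow> ?R")
proof
  assume cm: "consistent L nrm \<and> monotonic L nrm"
  show ?R
  proof (intro allI impI ballI conjI)
    fix n m js X assume mn: "m \<le> n" and js: "js \<in> increasing_seqs n m" and X: "X \<in> L n"
    note Y = truncate_closed[OF js X]
    show "N (truncate js X) \<le> N X"
    proof (cases "m = 0")
      case True
      then show ?thesis
        using N_nonneg[OF X] carrier[OF Y] by (simp add: zero_ext_def)
    next
      case False
      then show ?thesis
        using cm mn js X N_eq[OF _ carrier[OF X]] N_eq[OF _ carrier[OF Y]]
        by (auto simp: monotonic_def Suc_le_eq)
    qed
  next
    fix n m js X assume mn: "m \<le> n" and js: "js \<in> increasing_seqs n m" and X: "X \<in> L m"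
    note Y = lift_closed[OF js X]
    show "N (lift n js X) \<le> N X"
    proof (cases "m = 0")
      case True
      then have "lift n js X = 0\<^sub>m n n"
        using js by (intro eq_matI) (auto simp: lift_def increasing_seqs_def)
      then show ?thesis
        using mat_seminorm_zero[OF subspace N_seminorm] N_nonneg[OF X] by simp
    next
      case False
      then have "nrm (truncate js (lift n js X)) = nrm (lift n js (truncate js (lift n js X)))"
        using cm mn js Y by (simp add: consistent_def Suc_le_eq)
      then show ?thesis
        using False mn N_eq[OF _ carrier[OF X]] N_eq[OF _ carrier[OF Y]]
        by (simp add: truncate_lift[OF js carrier[OF X]])
    qed
  qed
next
  assume R: ?R
  show "consistent L nrm \<and> monotonic L nrm"
    unfolding consistent_def monotonic_def
  proof (intro conjI allI impI ballI)
    fix d k X "is" assume dk: "1 \<le> k \<and> k \<le> d" and X: "X \<in> L d" and js: "is \<in> increasing_seqs d k"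
    note Y = truncate_closed[OF js X]
    note Z = lift_closed[OF js Y]
    have d: "1 \<le> d"
      using dk by simp
    have N: "N X = nrm X" "N (truncate is X) = nrm (truncate is X)"
      "N (lift d is (truncate is X)) = nrm (lift d is (truncate is X))"
      using dk by (simp_all add: N_eq[OF d carrier[OF X]] N_eq[OF _ carrier[OF Y]] N_eq[OF d carrier[OF Z]])
    show "nrm (truncate is X) \<le> nrm X"
      using R dk js X N(1,2) by fastforce
    have "N (lift d is (truncate is X)) \<le> N (truncate is X)"
      using R dk js Y by blast
    moreover have "N (truncate is (lift d is (truncate is X))) \<le> N (lift d is (truncate is X))"
      using R dk js Z by blast
    ultimately show "nrm (truncate is X) = nrm (lift d is (truncate is X))"
      using N by (simp add: truncate_lift[OF js carrier[OF Y]])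
  qed
qed

end

theorem (in matrix_spaces) embedding_property_norm_cone_iff:
  assumes "norm_on_spaces L nrm"
  shows "consistent L nrm \<and> monotonic L nrm \<longleftrightarrow>
    embedding_property (norm_cone_space L) (norm_cone L nrm) soc_index"
proof -
  interpret normed_matrix_spaces L nrm
    using assms by unfold_locales
  show ?thesis
    by (simp only: consistent_monotonic_iff embedding_property_iff)
qed

interpretation hermitian: matrix_spaces "hermitian_mats :: nat \<Rightarrow> 'a::hypercomplex mat set"
  by unfold_locales
    (rule mat_subspace_hermitian hermitian_seminorm_bounded truncate_hermitian lift_hermitian; assumption?)+

interpretation diagonal: matrix_spaces diagonal_mats
  by unfold_locales
    (rule mat_subspace_diagonal diagonal_seminorm_bounded truncate_diagonal lift_diagonal; assumption?)+

theorem theorem7p2: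
  "(\<forall>nrm :: real mat \<Rightarrow> real. norm_on_spaces hermitian_mats nrm \<longrightarrow>
      (consistent hermitian_mats nrm \<and> monotonic hermitian_mats nrm \<longleftrightarrow>
       embedding_property (norm_cone_space hermitian_mats) (norm_cone hermitian_mats nrm) soc_index)) \<and>
   (\<forall>nrm :: complex mat \<Rightarrow> real. norm_on_spaces hermitian_mats nrm \<longrightarrow>
      (consistent hermitian_mats nrm \<and> monotonic hermitian_mats nrm \<longleftrightarrow>
       embedding_property (norm_cone_space hermitian_mats) (norm_cone hermitian_mats nrm) soc_index)) \<and>
   (\<forall>nrm :: quaternion mat \<Rightarrow> real. norm_on_spaces hermitian_mats nrm \<longrightarrow>
      (consistent hermitian_mats nrm \<and> monotonic hermitian_mats nrm \<longleftrightarrow>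
       embedding_property (norm_cone_space hermitian_mats) (norm_cone hermitian_mats nrm) soc_index)) \<and>
   (\<forall>nrm :: octonion mat \<Rightarrow> real. norm_on_spaces hermitian_mats nrm \<longrightarrow>
      (consistent hermitian_mats nrm \<and> monotonic hermitian_mats nrm \<longleftrightarrow>
       embedding_property (norm_cone_space hermitian_mats) (norm_cone hermitian_mats nrm) soc_index)) \<and>
   (\<forall>nrm :: real mat \<Rightarrow> real. norm_on_spaces diagonal_mats nrm \<longrightarrow>
      (consistent diagonal_mats nrm \<and> monotonic diagonal_mats nrm \<longleftrightarrow>
       embedding_property (norm_cone_space diagonal_mats) (norm_cone diagonal_mats nrm) soc_index))"
  by (intro conjI allI impI hermitian.embedding_property_norm_cone_iff
      diagonal.embedding_property_norm_cone_iff)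

end
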